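(* Let $(\beta_i)_{i=0}^{\infty}$ be a sequence of positive real numbers such that (1) $\sum_{i=0}^{\infty}\beta_i<1$; (2) $\sqrt{n}\sum_{i=n}^{\infty}\beta_i\to 0$ as $n\to\infty$; (3) $\frac{1}{\sqrt{n}}\sum_{i=1}^{n} i\beta_i\to 0$ as $n\to\infty$; (4) $\sum_{i=1}^{\infty} i\beta_i<\infty$. Let $\{\Lambda_n\}_{n\ge 1}$ be the compensator of the discrete-time Hawkes process with parameters $(\beta_i)_{i\ge 0}$. Then $$\frac{\Lambda_n}{n}\to\frac{\beta_0}{1-\sum_{i=1}^{\infty}\beta_i}\quad\text{in probability as } n\to\infty.$$
   Context: Discrete-time Hawkes process (DTHP): on a probability space $(\Omega,\mathcal{F},\mathbb{P})$, let $(\xi_n)_{n\ge 1}$ be $\{0,1\}$-valued random variables with $\mathbb{P}(\xi_1=1)=\beta_0$ and, for $n\ge 2$, $\mathbb{P}(\xi_n=1\mid \xi_1,\ldots,\xi_{n-1})=\beta_0+\sum_{i=1}^{n-1}\beta_{n-i}\xi_i$ (and $\xi_n=0$ with the complementary conditional probability). The DTHP is $H_n=\sum_{i=1}^n\xi_i$, $n\ge 1$. Let $\mathcal{F}_n=\sigma(\xi_1,\ldots,\xi_n)$, with $\mathcal{F}_0$ trivial. The compensator of the DTHP is $\Lambda_n=\sum_{i=1}^n\mathbb{E}(\xi_i\mid\mathcal{F}_{i-1})$, the increasing predictable part in the Doob decomposition of $H_n$. *)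

theory Defs
  imports "HOL-Probability.Probability"
begin

definition tendsto_in_prob ::
  "'a measure \<Rightarrow> (nat \<Rightarrow> 'a \<Rightarrow> real) \<Rightarrow> ('a \<Rightarrow> real) \<Rightarrow> bool" where
  "tendsto_in_prob M X Y \<longleftrightarrow>
     (\<forall>\<epsilon>>0. (\<lambda>n. measure M {\<omega> \<in> space M. \<bar>X n \<omega> - Y \<omega>\<bar> > \<epsilon>}) \<longlonglongrightarrow> 0)"

(* sigma(xi_1, ..., xi_n).  It is generated explicitly on space M, because a supremum of
   vimage_algebras over the empty index set (n = 0) would have the empty set as its space,
   whereas F_0 has to be the trivial sigma-algebra {{}, space M}. *)
definition nat_filtration :: "'a measure \<Rightarrow> (nat \<Rightarrow> 'a \<Rightarrow> real) \<Rightarrow> nat \<Rightarrow> 'a measure" where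
  "nat_filtration M \<xi> n =
     sigma (space M) (\<Union>i\<in>{1..n}. {\<xi> i -` A \<inter> space M | A. A \<in> sets borel})"

(* The arrivals are indexed from 1; the value of xi at index 0 is irrelevant.
   P(xi_n = 1 | xi_1, ..., xi_(n-1)) is the conditional expectation of the indicator of
   {xi_n = 1}; the conditional probability of {xi_n = 0} is then its complement because
   xi_n takes values in {0, 1}. *)
locale discrete_time_hawkes = prob_space M for M :: "'a measure" +
  fixes \<beta> :: "nat \<Rightarrow> real" and \<xi> :: "nat \<Rightarrow> 'a \<Rightarrow> real"
  assumes arrival_measurable: "\<And>n. n \<ge> 1 \<Longrightarrow> \<xi> n \<in> borel_measurable M"
    and arrival_values: "\<And>n \<omega>. n \<ge> 1 \<Longrightarrow> \<omega> \<in> space M \<Longrightarrow> \<xi> n \<omega> \<in> {0, 1}"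
    and first_arrival: "measure M {\<omega> \<in> space M. \<xi> 1 \<omega> = 1} = \<beta> 0"
    and cond_arrival: "\<And>n. n \<ge> 2 \<Longrightarrow>
      AE \<omega> in M.
        real_cond_exp M (nat_filtration M \<xi> (n - 1))
          (indicator {\<omega>' \<in> space M. \<xi> n \<omega>' = 1}) \<omega>
        = \<beta> 0 + (\<Sum>i=1..n-1. \<beta> (n - i) * \<xi> i \<omega>)"

(* The compensator of the process H_n = xi_1 + ... + xi_n. *)
definition hawkes_compensator :: "'a measure \<Rightarrow> (nat \<Rightarrow> 'a \<Rightarrow> real) \<Rightarrow> nat \<Rightarrow> 'a \<Rightarrow> real" where
  "hawkes_compensator M \<xi> n \<omega> =
     (\<Sum>i=1..n. real_cond_exp M (nat_filtration M \<xi> (i - 1)) (\<xi> i) \<omega>)"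

end

theory Submission
  imports Defs
begin

text \<open>
  Write \<open>b\<close> for the sum of the \<open>\<beta> i\<close> over \<open>i \<ge> 1\<close> and \<open>N\<close> for the martingale part \<open>H - \<Lambda>\<close> of the
  Doob decomposition. Interchanging the order of summation in the compensator gives
  \<open>\<Lambda> n = n \<beta> 0 + b H n - R n\<close>, where \<open>R n\<close> is nonnegative and bounded by the first moment of \<open>\<beta>\<close>.
  Substituting \<open>H = N + \<Lambda>\<close> yields \<open>(1 - b) \<Lambda> n = n \<beta> 0 + b N n - R n\<close>. The increments of \<open>N\<close> are
  orthogonal and bounded by 1, so \<open>N n\<close> has second moment at most \<open>n\<close>, and Chebyshev's inequality
  applied to \<open>b N n - R n\<close> finishes the proof.
\<close>

text \<open>An explicit version of the conditional mean of \<open>\<xi> n\<close> given the past, so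
  that bounds can hold at every point and not merely almost everywhere. At \<open>n = 1\<close> the
  sum is empty, which leaves the unconditional mean \<open>\<beta> 0\<close>.\<close>

definition hawkes_intensity :: "(nat \<Rightarrow> real) \<Rightarrow> (nat \<Rightarrow> 'a \<Rightarrow> real) \<Rightarrow> nat \<Rightarrow> 'a \<Rightarrow> real" where
  "hawkes_intensity \<beta> \<xi> n \<omega> = \<beta> 0 + (\<Sum>i=1..n-1. \<beta> (n - i) * \<xi> i \<omega>)"

text \<open>Built from the explicit intensity, so it agrees with the arrival count minus
  \<open>hawkes_compensator\<close> only almost surely.\<close>

definition hawkes_martingale :: "(nat \<Rightarrow> real) \<Rightarrow> (nat \<Rightarrow> 'a \<Rightarrow> real) \<Rightarrow> nat \<Rightarrow> 'a \<Rightarrow> real" where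
  "hawkes_martingale \<beta> \<xi> n \<omega> = (\<Sum>m=1..n. \<xi> m \<omega> - hawkes_intensity \<beta> \<xi> m \<omega>)"

section \<open>Tails of convergent series\<close>

definition series_tail :: "(nat \<Rightarrow> real) \<Rightarrow> nat \<Rightarrow> real" where
  "series_tail f n = (\<Sum>i. f (n + i))"

lemma series_tail_Suc:
  assumes "summable f"
  shows "series_tail f n = f n + series_tail f (Suc n)"
proof -
  have "summable (\<lambda>i. f (n + i))"
    using assms summable_iff_shift[of f n] by (simp add: add.commute)
  from suminf_split_head[OF this] show ?thesis
    by (simp add: series_tail_def)
qed

lemma series_tail_nonneg:
  assumes "summable f" "\<And>i. f i \<ge> 0"
  shows "series_tail f n \<ge> 0"
proof -
  have "summable (\<lambda>i. f (n + i))"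
    using assms summable_iff_shift[of f n] by (simp add: add.commute)
  with assms(2) show ?thesis
    by (simp add: series_tail_def suminf_nonneg)
qed

text \<open>The term \<open>f i\<close> occurs in those of the first \<open>n\<close> tails that
  start at or before \<open>i\<close>, hence at most \<open>Suc i\<close> times.\<close>

lemma sum_series_tail_le:
  fixes f :: "nat \<Rightarrow> real"
  assumes f: "summable f" "\<And>i. f i \<ge> 0"
    and moment: "summable (\<lambda>i. real (Suc i) * f i)"
  shows "(\<Sum>k<n. series_tail f k) \<le> (\<Sum>i. real (Suc i) * f i)"
proof -
  \<comment> \<open>Abel summation; what remains is to absorb the boundary term
    \<open>real n * series_tail f n\<close>.\<close>
  have abel: "(\<Sum>k<n. series_tail f k) = (\<Sum>i<n. real (Suc i) * f i) + real n * series_tail f n"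
  proof (induction n)
    case (Suc n)
    then show ?case
      using series_tail_Suc[OF f(1), of n] by (simp add: algebra_simps)
  qed simp
  have shift: "summable (\<lambda>i. f (i + n))" "summable (\<lambda>i. real (Suc (i + n)) * f (i + n))"
    using f(1) moment summable_iff_shift[of f n]
      summable_iff_shift[of "\<lambda>i. real (Suc i) * f i" n] by auto
  \<comment> \<open>Past index \<open>n\<close> the weight \<open>n\<close> is below the weight of
    the moment series, so the boundary term is at most the part of that series left out of the
    finite sum.\<close>
  have "real n * series_tail f n = (\<Sum>i. real n * f (i + n))"
    unfolding series_tail_def using suminf_mult[OF shift(1), of "real n"] by (simp add: add.commute)
  also have "\<dots> \<le> (\<Sum>i. real (Suc (i + n)) * f (i + n))"
    by (intro suminf_le shift summable_mult mult_right_mono f) auto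
  finally show ?thesis
    using suminf_split_initial_segment[OF moment, of n] abel by linarith
qed

text \<open>By time \<open>n\<close> an arrival at \<open>j\<close> has contributed the coefficients
  with indices 1 to \<open>n - j\<close>, that is, the whole sum less the tail beyond
  \<open>n - j\<close>. Induction on \<open>n\<close> replaces the interchange of a double
  sum.\<close>

lemma sum_hawkes_intensity:
  assumes "summable (\<lambda>i. \<beta> (Suc i))"
  shows "(\<Sum>m=1..n. hawkes_intensity \<beta> \<xi> m \<omega>) =
    real n * \<beta> 0 + (\<Sum>i. \<beta> (Suc i)) * (\<Sum>m=1..n. \<xi> m \<omega>)
      - (\<Sum>j=1..n. series_tail (\<lambda>i. \<beta> (Suc i)) (n - j) * \<xi> j \<omega>)"
proof (induction n)
  case (Suc n)
  let ?T = "series_tail (\<lambda>i. \<beta> (Suc i))"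
  \<comment> \<open>Passing to \<open>Suc n\<close> strips the first term off each tail, and the
    stripped terms make up the sum in the new intensity. The new arrival enters with the full tail
    \<open>?T 0\<close>, which cancels its share in the second summand.\<close>
  have "(\<Sum>j=1..n. ?T (n - j) * \<xi> j \<omega>)
      = (\<Sum>j=1..n. \<beta> (Suc n - j) * \<xi> j \<omega> + ?T (Suc n - j) * \<xi> j \<omega>)"
    by (intro sum.cong refl) (auto simp: series_tail_Suc[OF assms, of "n - _"] Suc_diff_le algebra_simps)
  then show ?case
    using Suc by (simp add: hawkes_intensity_def sum.distrib series_tail_def algebra_simps)
qed simp

section \<open>The natural filtration\<close>

lemma space_nat_filtration [simp]: "space (nat_filtration M \<xi> n) = space M"
  by (simp add: nat_filtration_def space_measure_of_conv)

lemma measurable_nat_filtration: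
  assumes "1 \<le> i" "i \<le> n"
  shows "\<xi> i \<in> borel_measurable (nat_filtration M \<xi> n)"
proof (rule measurableI)
  fix A :: "real set" assume "A \<in> sets borel"
  then show "\<xi> i -` A \<inter> space (nat_filtration M \<xi> n) \<in> sets (nat_filtration M \<xi> n)"
    unfolding nat_filtration_def space_measure_of_conv
    using assms by (subst sets_measure_of) (auto intro!: sigma_sets.Basic bexI[of _ i] exI[of _ A])
qed auto

section \<open>Conditional means of the arrivals and the compensator\<close>

context discrete_time_hawkes
begin

lemma subalgebra_nat_filtration: "subalgebra M (nat_filtration M \<xi> n)"
proof -
  have "(\<Union>i\<in>{1..n}. {\<xi> i -` A \<inter> space M | A. A \<in> sets borel}) \<subseteq> sets M"
    using arrival_measurable by (auto intro: measurable_sets)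
  then have "sets (nat_filtration M \<xi> n) \<subseteq> sets M"
    unfolding nat_filtration_def by (subst sets_measure_of) (auto intro!: sets.sigma_sets_subset)
  then show ?thesis
    by (simp add: subalgebra_def)
qed

lemma sigma_finite_subalgebra_nat_filtration:
  "sigma_finite_subalgebra M (nat_filtration M \<xi> n)"
  using subalgebra_nat_filtration
  by (intro finite_measure_subalgebra_is_sigma_finite)
     (simp add: finite_measure_subalgebra_def finite_measure_subalgebra_axioms_def finite_measure_axioms)

lemma arrival_bounds:
  assumes "n \<ge> 1" "\<omega> \<in> space M"
  shows "0 \<le> \<xi> n \<omega>" "\<xi> n \<omega> \<le> 1"
  using arrival_values[OF assms] by auto

lemma integrable_arrival:
  assumes "n \<ge> 1"
  shows "integrable M (\<xi> n)"
  using arrival_measurable[OF assms] arrival_bounds[OF assms]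
  by (intro integrable_const_bound[where B = 1]) auto

text \<open>On the space an arrival equals the indicator of its being 1, so for
  \<open>n \<ge> 2\<close> the model assumption applies directly. For \<open>n = 1\<close> the
  conditioning is trivial and only the mean of the first arrival matters.\<close>

lemma cond_exp_arrival:
  assumes n: "n \<ge> 1"
  shows "AE \<omega> in M. real_cond_exp M (nat_filtration M \<xi> (n - 1)) (\<xi> n) \<omega> = hawkes_intensity \<beta> \<xi> n \<omega>"
proof -
  interpret sigma_finite_subalgebra M "nat_filtration M \<xi> (n - 1)"
    by (rule sigma_finite_subalgebra_nat_filtration)
  note [measurable] = arrival_measurable[OF n]
  let ?I = "indicator {\<omega>' \<in> space M. \<xi> n \<omega>' = 1} :: 'a \<Rightarrow> real"
  have eq: "\<xi> n \<omega> = ?I \<omega>" if "\<omega> \<in> space M" for \<omega>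
    using arrival_values[OF n that] that by (auto simp: indicator_def)
  show ?thesis
  proof (cases "n = 1")
    case True
    have sets: "sets (nat_filtration M \<xi> (n - 1)) = {{}, space M}"
      using True by (simp add: nat_filtration_def sigma_sets_empty_eq)
    have "expectation (\<xi> n) = expectation ?I"
      by (intro Bochner_Integration.integral_cong eq) auto
    also have "\<dots> = \<beta> 0"
      using first_arrival True by (simp add: Int_absorb2 Collect_restrict)
    finally have mean: "expectation (\<xi> n) = \<beta> 0" .
    \<comment> \<open>A constant has to match the integrals of \<open>\<xi> n\<close> over the two
      sets of the trivial sigma-algebra only.\<close>
    have "AE \<omega> in M. real_cond_exp M (nat_filtration M \<xi> (n - 1)) (\<xi> n) \<omega> = \<beta> 0"
    proof (rule real_cond_exp_charact)
      fix A assume "A \<in> sets (nat_filtration M \<xi> (n - 1))"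
      then consider "A = {}" | "A = space M"
        using sets by auto
      then show "(\<integral>\<omega>\<in>A. \<xi> n \<omega> \<partial>M) = (\<integral>\<omega>\<in>A. \<beta> 0 \<partial>M)"
      proof cases
        case 1
        then show ?thesis by (simp add: set_lebesgue_integral_def)
      next
        case 2
        then show ?thesis by (simp add: set_integral_space integrable_arrival[OF n] mean prob_space)
      qed
    qed (auto simp: integrable_arrival[OF n])
    then show ?thesis
      using True by (simp add: hawkes_intensity_def)
  next
    case False
    have "AE \<omega> in M. real_cond_exp M (nat_filtration M \<xi> (n - 1)) (\<xi> n) \<omega>
        = real_cond_exp M (nat_filtration M \<xi> (n - 1)) ?I \<omega>"
      by (rule real_cond_exp_cong) (auto intro!: AE_I2 eq)
    moreover have "AE \<omega> in M. real_cond_exp M (nat_filtration M \<xi> (n - 1)) ?I \<omega>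
        = hawkes_intensity \<beta> \<xi> n \<omega>"
      using cond_arrival[of n] n False by (simp add: hawkes_intensity_def)
    ultimately show ?thesis
      by eventually_elim simp
  qed
qed

text \<open>Predictability: the intensity at \<open>m\<close> involves arrivals up to
  \<open>m - 1\<close> only, hence the bound \<open>Suc n\<close> instead of
  \<open>n\<close>.\<close>

lemma measurable_hawkes_intensity:
  assumes "m \<le> Suc n"
  shows "hawkes_intensity \<beta> \<xi> m \<in> borel_measurable (nat_filtration M \<xi> n)"
  unfolding hawkes_intensity_def[abs_def] using assms
  by (intro borel_measurable_add borel_measurable_sum borel_measurable_times measurable_nat_filtration) auto

lemma measurable_hawkes_martingale:
  "hawkes_martingale \<beta> \<xi> n \<in> borel_measurable (nat_filtration M \<xi> n)"
  unfolding hawkes_martingale_def[abs_def]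
  by (intro borel_measurable_sum borel_measurable_diff measurable_nat_filtration
      measurable_hawkes_intensity) auto

lemma hawkes_martingale_borel_measurable [measurable]: "hawkes_martingale \<beta> \<xi> n \<in> borel_measurable M"
  using measurable_from_subalg[OF subalgebra_nat_filtration measurable_hawkes_martingale] .

lemma hawkes_intensity_borel_measurable [measurable]: "hawkes_intensity \<beta> \<xi> n \<in> borel_measurable M"
  by (rule measurable_from_subalg[OF subalgebra_nat_filtration measurable_hawkes_intensity[of n n]]) simp

text \<open>Finitely many null sets are discarded for each \<open>n\<close>. The exceptional set may
  depend on \<open>n\<close>, which is harmless for convergence in probability.\<close>

lemma hawkes_compensator_eq_sum_intensity:
  "AE \<omega> in M. hawkes_compensator M \<xi> n \<omega> = (\<Sum>m=1..n. hawkes_intensity \<beta> \<xi> m \<omega>)"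
proof -
  have "AE \<omega> in M. \<forall>m\<in>{1..n}. real_cond_exp M (nat_filtration M \<xi> (m - 1)) (\<xi> m) \<omega>
      = hawkes_intensity \<beta> \<xi> m \<omega>"
    by (intro AE_finite_allI cond_exp_arrival) auto
  then show ?thesis
    by eventually_elim (simp add: hawkes_compensator_def)
qed

end

section \<open>Second moment of the martingale part\<close>

locale subcritical_hawkes = discrete_time_hawkes +
  assumes nonneg: "\<And>i. \<beta> i \<ge> 0"
    and summable: "summable \<beta>"
    and suminf_le_1: "(\<Sum>i. \<beta> i) \<le> 1"
begin

lemma hawkes_intensity_bounds:
  assumes n: "n \<ge> 1" and \<omega>: "\<omega> \<in> space M"
  shows "0 \<le> hawkes_intensity \<beta> \<xi> n \<omega>" "hawkes_intensity \<beta> \<xi> n \<omega> \<le> 1"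
proof -
  show "0 \<le> hawkes_intensity \<beta> \<xi> n \<omega>"
    unfolding hawkes_intensity_def
    by (intro add_nonneg_nonneg sum_nonneg mult_nonneg_nonneg nonneg arrival_bounds \<omega>) auto
  have "hawkes_intensity \<beta> \<xi> n \<omega> \<le> \<beta> 0 + (\<Sum>i=1..n-1. \<beta> (n - i))"
    unfolding hawkes_intensity_def
    by (intro add_left_mono sum_mono mult_left_le nonneg arrival_bounds \<omega>) auto
  \<comment> \<open>Reversing the index shows that, together with \<open>\<beta> 0\<close>, each
    coefficient is used once, so the total mass bounds the intensity.\<close>
  also have "(\<Sum>i=1..n-1. \<beta> (n - i)) = (\<Sum>i=1..n-1. \<beta> i)"
    using n by (intro sum.reindex_bij_witness[of _ "\<lambda>i. n - i" "\<lambda>i. n - i"]) auto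
  also have "\<beta> 0 + \<dots> = (\<Sum>i\<in>insert 0 {1..n-1}. \<beta> i)"
    by simp
  also have "\<dots> \<le> (\<Sum>i. \<beta> i)"
    using nonneg summable by (intro sum_le_suminf) auto
  finally show "hawkes_intensity \<beta> \<xi> n \<omega> \<le> 1"
    using suminf_le_1 by simp
qed

lemma abs_increment_le_1:
  assumes "n \<ge> 1" "\<omega> \<in> space M"
  shows "\<bar>\<xi> n \<omega> - hawkes_intensity \<beta> \<xi> n \<omega>\<bar> \<le> 1"
  using arrival_bounds[OF assms] hawkes_intensity_bounds[OF assms] by (simp add: abs_le_iff)

lemma abs_hawkes_martingale_le:
  assumes "\<omega> \<in> space M"
  shows "\<bar>hawkes_martingale \<beta> \<xi> n \<omega>\<bar> \<le> real n"
proof -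
  have "\<bar>hawkes_martingale \<beta> \<xi> n \<omega>\<bar> \<le> (\<Sum>m=1..n. \<bar>\<xi> m \<omega> - hawkes_intensity \<beta> \<xi> m \<omega>\<bar>)"
    unfolding hawkes_martingale_def by (rule sum_abs)
  also have "\<dots> \<le> (\<Sum>m=1..n. 1)"
    using assms by (intro sum_mono abs_increment_le_1) auto
  finally show ?thesis
    by simp
qed

lemma integrable_hawkes_martingale_square: "integrable M (\<lambda>\<omega>. (hawkes_martingale \<beta> \<xi> n \<omega>)\<^sup>2)"
proof (rule integrable_const_bound[where B = "(real n)\<^sup>2"])
  show "AE \<omega> in M. norm ((hawkes_martingale \<beta> \<xi> n \<omega>)\<^sup>2) \<le> (real n)\<^sup>2"
    using abs_hawkes_martingale_le by (auto intro!: AE_I2 simp: abs_le_square_iff[symmetric])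
qed simp

text \<open>\<open>N n\<close> is known at time \<open>n\<close>, so it can be moved inside the
  conditional expectation, where the next increment has mean zero.\<close>

lemma martingale_increment_orthogonal:
  defines "N \<equiv> hawkes_martingale \<beta> \<xi>" and "p \<equiv> hawkes_intensity \<beta> \<xi>"
  shows "integrable M (\<lambda>\<omega>. N n \<omega> * (\<xi> (Suc n) \<omega> - p (Suc n) \<omega>))"
    and "expectation (\<lambda>\<omega>. N n \<omega> * (\<xi> (Suc n) \<omega> - p (Suc n) \<omega>)) = 0"
proof -
  interpret F: sigma_finite_subalgebra M "nat_filtration M \<xi> n"
    by (rule sigma_finite_subalgebra_nat_filtration)
  have [measurable]: "\<xi> (Suc n) \<in> borel_measurable M" "N n \<in> borel_measurable M"
    "p (Suc n) \<in> borel_measurable M"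
    by (simp_all add: arrival_measurable N_def p_def)
  \<comment> \<open>Integrability of the two products comes from \<open>N n\<close> being at most
    \<open>n\<close> in absolute value while the other factor lies in [0, 1].\<close>
  have bounded: "\<bar>N n \<omega> * \<xi> (Suc n) \<omega>\<bar> \<le> real n" "\<bar>N n \<omega> * p (Suc n) \<omega>\<bar> \<le> real n"
    if "\<omega> \<in> space M" for \<omega>
    using mult_mono[OF abs_hawkes_martingale_le[OF that, of n]]
      arrival_bounds[OF _ that, of "Suc n"] hawkes_intensity_bounds[OF _ that, of "Suc n"]
    by (auto simp: abs_mult N_def p_def) (metis mult.right_neutral)+
  have int\<xi>: "integrable M (\<lambda>\<omega>. N n \<omega> * \<xi> (Suc n) \<omega>)"
    using bounded by (intro integrable_const_bound[where B = "real n"]) auto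
  have intp: "integrable M (\<lambda>\<omega>. N n \<omega> * p (Suc n) \<omega>)"
    using bounded by (intro integrable_const_bound[where B = "real n"]) auto
  show "integrable M (\<lambda>\<omega>. N n \<omega> * (\<xi> (Suc n) \<omega> - p (Suc n) \<omega>))"
    using int\<xi> intp by (simp add: right_diff_distrib)
  have "expectation (\<lambda>\<omega>. N n \<omega> * \<xi> (Suc n) \<omega>)
      = expectation (\<lambda>\<omega>. N n \<omega> * real_cond_exp M (nat_filtration M \<xi> n) (\<xi> (Suc n)) \<omega>)"
    using int\<xi> by (intro F.real_cond_exp_intg(2)[symmetric])
      (auto simp: N_def measurable_hawkes_martingale)
  also have "\<dots> = expectation (\<lambda>\<omega>. N n \<omega> * p (Suc n) \<omega>)"
    using cond_exp_arrival[of "Suc n"]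
    by (intro integral_cong_AE) (auto simp: p_def)
  finally show "expectation (\<lambda>\<omega>. N n \<omega> * (\<xi> (Suc n) \<omega> - p (Suc n) \<omega>)) = 0"
    using int\<xi> intp by (simp add: right_diff_distrib)
qed

text \<open>Each new increment adds at most 1: its square is at most 1 and the cross term has mean
  zero.\<close>

lemma hawkes_martingale_second_moment:
  "expectation (\<lambda>\<omega>. (hawkes_martingale \<beta> \<xi> n \<omega>)\<^sup>2) \<le> real n"
proof (induction n)
  case 0
  then show ?case by (simp add: hawkes_martingale_def)
next
  case (Suc n)
  let ?N = "hawkes_martingale \<beta> \<xi>"
  let ?D = "\<lambda>\<omega>. \<xi> (Suc n) \<omega> - hawkes_intensity \<beta> \<xi> (Suc n) \<omega>"
  note orth = martingale_increment_orthogonal[of n]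
  have "expectation (\<lambda>\<omega>. (?N (Suc n) \<omega>)\<^sup>2) \<le> expectation (\<lambda>\<omega>. (?N n \<omega>)\<^sup>2 + 2 * (?N n \<omega> * ?D \<omega>) + 1)"
  proof (rule integral_mono)
    fix \<omega> assume "\<omega> \<in> space M"
    then have "(?D \<omega>)\<^sup>2 \<le> 1"
      using abs_increment_le_1[of "Suc n" \<omega>] by (simp add: abs_square_le_1)
    moreover have "?N (Suc n) \<omega> = ?N n \<omega> + ?D \<omega>"
      by (simp add: hawkes_martingale_def)
    ultimately show "(?N (Suc n) \<omega>)\<^sup>2 \<le> (?N n \<omega>)\<^sup>2 + 2 * (?N n \<omega> * ?D \<omega>) + 1"
      by (simp add: power2_sum)
  qed (intro Bochner_Integration.integrable_add integrable_mult_right orth(1)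
      integrable_hawkes_martingale_square integrable_const)+
  also have "\<dots> = expectation (\<lambda>\<omega>. (?N n \<omega>)\<^sup>2) + 1"
    using orth integrable_hawkes_martingale_square[of n] by (simp add: prob_space)
  finally show ?case
    using Suc by simp
qed

end

section \<open>Convergence in probability\<close>

theorem theorem5p2:
  fixes M :: "'a measure" and \<beta> :: "nat \<Rightarrow> real" and \<xi> :: "nat \<Rightarrow> 'a \<Rightarrow> real"
  assumes pos: "\<And>i. \<beta> i > 0"
    and summable: "summable \<beta>"
    and sum_less_1: "(\<Sum>i. \<beta> i) < 1"
    and tail: "(\<lambda>n. sqrt (real n) * (\<Sum>i. \<beta> (n + i))) \<longlonglongrightarrow> 0"
    and weighted: "(\<lambda>n. 1 / sqrt (real n) * (\<Sum>i=1..n. real i * \<beta> i)) \<longlonglongrightarrow> 0"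
    and first_moment: "summable (\<lambda>i. real (Suc i) * \<beta> (Suc i))"
    and hawkes: "discrete_time_hawkes M \<beta> \<xi>"
  shows "tendsto_in_prob M (\<lambda>n \<omega>. hawkes_compensator M \<xi> n \<omega> / real n)
           (\<lambda>\<omega>. \<beta> 0 / (1 - (\<Sum>i. \<beta> (Suc i))))"
proof -
  interpret subcritical_hawkes M \<beta> \<xi>
    using hawkes pos summable sum_less_1
    by (simp add: subcritical_hawkes_def subcritical_hawkes_axioms_def less_imp_le)
  let ?\<beta>' = "\<lambda>i. \<beta> (Suc i)" and ?N = "hawkes_martingale \<beta> \<xi>"
  define b where "b = (\<Sum>i. ?\<beta>' i)"
  define K where "K = (\<Sum>i. real (Suc i) * ?\<beta>' i)"
  define R where "R n \<omega> = (\<Sum>j=1..n. series_tail ?\<beta>' (n - j) * \<xi> j \<omega>)" for n \<omega>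
  have summable': "summable ?\<beta>'"
    using summable by (simp add: summable_Suc_iff)
  have "b < 1"
    using suminf_split_head[OF summable] sum_less_1 pos[of 0] by (simp add: b_def)
  have [measurable]: "R n \<in> borel_measurable M" for n
    unfolding R_def[abs_def] by (intro borel_measurable_sum borel_measurable_times arrival_measurable) auto
  have R_bounds: "0 \<le> R n \<omega>" "R n \<omega> \<le> K" if "\<omega> \<in> space M" for n \<omega>
  proof -
    have nonneg': "0 \<le> series_tail ?\<beta>' k" for k
      by (rule series_tail_nonneg) (auto simp: summable' nonneg)
    show "0 \<le> R n \<omega>"
      unfolding R_def using that by (intro sum_nonneg mult_nonneg_nonneg nonneg' arrival_bounds) auto
    \<comment> \<open>Arrivals are at most 1; reversing the order of summation then leaves the first
      \<open>n\<close> tails, bounded by the first moment \<open>K\<close> uniformly in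
      \<open>n\<close> and \<open>\<omega>\<close>.\<close>
    have "R n \<omega> \<le> (\<Sum>j=1..n. series_tail ?\<beta>' (n - j))"
      unfolding R_def using that by (intro sum_mono mult_left_le nonneg' arrival_bounds) auto
    also have "\<dots> = (\<Sum>k<n. series_tail ?\<beta>' k)"
      by (intro sum.reindex_bij_witness[of _ "\<lambda>k. n - k" "\<lambda>j. n - j"]) auto
    also have "\<dots> \<le> K"
      unfolding K_def using summable' first_moment nonneg by (intro sum_series_tail_le) auto
    finally show "R n \<omega> \<le> K" .
  qed
  have moment_bound: "integrable M (\<lambda>\<omega>. (b * ?N n \<omega> - R n \<omega>)\<^sup>2)"
    "expectation (\<lambda>\<omega>. (b * ?N n \<omega> - R n \<omega>)\<^sup>2) \<le> 2 * b\<^sup>2 * real n + 2 * K\<^sup>2" for n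
  proof -
    have le: "(b * ?N n \<omega> - R n \<omega>)\<^sup>2 \<le> 2 * b\<^sup>2 * (?N n \<omega>)\<^sup>2 + 2 * K\<^sup>2" if "\<omega> \<in> space M" for \<omega>
    proof -
      \<comment> \<open>The bound \<open>(x - y)\<^sup>2 \<le> 2 * x\<^sup>2 + 2 * y\<^sup>2\<close>
        avoids handling the correlation of the martingale with \<open>R\<close>.\<close>
      have "(b * ?N n \<omega> - R n \<omega>)\<^sup>2 \<le> 2 * (b * ?N n \<omega>)\<^sup>2 + 2 * (R n \<omega>)\<^sup>2"
        using zero_le_power2[of "b * ?N n \<omega> + R n \<omega>"] by (simp add: power2_sum power2_diff)
      also have "(R n \<omega>)\<^sup>2 \<le> K\<^sup>2"
        using R_bounds[OF that] by (intro power_mono)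
      finally show ?thesis
        by (simp add: power_mult_distrib)
    qed
    have int: "integrable M (\<lambda>\<omega>. 2 * b\<^sup>2 * (?N n \<omega>)\<^sup>2 + 2 * K\<^sup>2)"
      using integrable_hawkes_martingale_square by auto
    show int': "integrable M (\<lambda>\<omega>. (b * ?N n \<omega> - R n \<omega>)\<^sup>2)"
      by (rule Bochner_Integration.integrable_bound[OF int]) (use le in \<open>auto intro!: AE_I2\<close>)
    have "expectation (\<lambda>\<omega>. (b * ?N n \<omega> - R n \<omega>)\<^sup>2)
        \<le> expectation (\<lambda>\<omega>. 2 * b\<^sup>2 * (?N n \<omega>)\<^sup>2 + 2 * K\<^sup>2)"
      by (intro integral_mono int int' le)
    also have "\<dots> = 2 * b\<^sup>2 * expectation (\<lambda>\<omega>. (?N n \<omega>)\<^sup>2) + 2 * K\<^sup>2"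
      using integrable_hawkes_martingale_square[of n] by (simp add: prob_space)
    also have "\<dots> \<le> 2 * b\<^sup>2 * real n + 2 * K\<^sup>2"
      by (intro add_right_mono mult_left_mono hawkes_martingale_second_moment) auto
    finally show "expectation (\<lambda>\<omega>. (b * ?N n \<omega> - R n \<omega>)\<^sup>2) \<le> 2 * b\<^sup>2 * real n + 2 * K\<^sup>2" .
  qed
  \<comment> \<open>Solving the linear relation for the compensator gives the error exactly. Its
    numerator has second moment of order \<open>n\<close>, while the squared denominator has order
    \<open>n\<close> squared.\<close>
  have deviation: "AE \<omega> in M. hawkes_compensator M \<xi> n \<omega> / real n - \<beta> 0 / (1 - b)
      = (b * ?N n \<omega> - R n \<omega>) / (real n * (1 - b))" if "n > 0" for n
    using hawkes_compensator_eq_sum_intensity[of n]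
  proof eventually_elim
    case (elim \<omega>)
    let ?\<Lambda> = "hawkes_compensator M \<xi> n \<omega>"
    define H where "H = (\<Sum>m=1..n. \<xi> m \<omega>)"
    have H: "H = ?N n \<omega> + ?\<Lambda>"
      by (simp add: hawkes_martingale_def sum_subtractf elim H_def)
    have "?\<Lambda> = real n * \<beta> 0 + b * H - R n \<omega>"
      using sum_hawkes_intensity[OF summable', of \<xi> \<omega> n] by (simp add: elim b_def R_def H_def)
    then have "(1 - b) * ?\<Lambda> - real n * \<beta> 0 = b * ?N n \<omega> - R n \<omega>"
      by (simp add: H algebra_simps)
    then show ?case
      using that \<open>b < 1\<close> by (simp add: field_simps)
  qed
  show ?thesis
    unfolding tendsto_in_prob_def b_def[symmetric]
  proof (intro allI impI)
    fix \<epsilon> :: real assume "\<epsilon> > 0"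
    define P where "P n = prob {\<omega> \<in> space M. \<bar>hawkes_compensator M \<xi> n \<omega> / real n - \<beta> 0 / (1 - b)\<bar> > \<epsilon>}" for n
    \<comment> \<open>The part of the squared Chebyshev threshold \<open>?a\<close> that is free of
      \<open>n\<close>.\<close>
    define c where "c = (\<epsilon> * (1 - b))\<^sup>2"
    have "c > 0"
      using \<open>\<epsilon> > 0\<close> \<open>b < 1\<close> by (simp add: c_def)
    have "P n \<le> (2 * b\<^sup>2 / real n + 2 * K\<^sup>2 / (real n)\<^sup>2) / c" if "n > 0" for n
    proof -
      let ?a = "\<epsilon> * (1 - b) * real n"
      have "?a > 0"
        using \<open>\<epsilon> > 0\<close> \<open>b < 1\<close> that by simp
      \<comment> \<open>The formula for the error holds almost surely, so the events are compared up
        to a null set. The strict inequality is relaxed to the form used in Chebyshev's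
        inequality.\<close>
      have "P n \<le> prob {\<omega> \<in> space M. ?a \<le> \<bar>b * ?N n \<omega> - R n \<omega>\<bar>}"
        unfolding P_def
      proof (rule finite_measure_mono_AE)
        show "AE \<omega> in M. \<omega> \<in> {\<omega> \<in> space M. \<epsilon> < \<bar>hawkes_compensator M \<xi> n \<omega> / real n - \<beta> 0 / (1 - b)\<bar>} \<longrightarrow>
            \<omega> \<in> {\<omega> \<in> space M. ?a \<le> \<bar>b * ?N n \<omega> - R n \<omega>\<bar>}"
          using deviation[OF that]
        proof eventually_elim
          case (elim \<omega>)
          have "\<epsilon> < \<bar>b * ?N n \<omega> - R n \<omega>\<bar> / (real n * (1 - b)) \<Longrightarrow> ?a \<le> \<bar>b * ?N n \<omega> - R n \<omega>\<bar>"
            using that \<open>b < 1\<close> by (simp add: field_simps)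
          then show ?case
            using that \<open>b < 1\<close> by (simp add: elim abs_mult)
        qed
      qed simp
      also have "\<dots> \<le> expectation (\<lambda>\<omega>. (b * ?N n \<omega> - R n \<omega>)\<^sup>2) / ?a\<^sup>2"
        using moment_bound(1) \<open>?a > 0\<close> by (intro second_moment_method) auto
      also have "\<dots> \<le> (2 * b\<^sup>2 * real n + 2 * K\<^sup>2) / ?a\<^sup>2"
        by (intro divide_right_mono moment_bound) auto
      also have "\<dots> = (2 * b\<^sup>2 / real n + 2 * K\<^sup>2 / (real n)\<^sup>2) / c"
      proof -
        have "?a\<^sup>2 = c * (real n)\<^sup>2"
          by (simp add: c_def power_mult_distrib)
        then show ?thesis
          using that \<open>c > 0\<close> by (simp only:) (simp add: field_simps power2_eq_square)
      qed
      finally show ?thesis .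
    qed
    moreover have "P n \<ge> 0" for n
      by (simp add: P_def)
    ultimately have "\<forall>\<^sub>F n in sequentially. norm (P n) \<le> (2 * b\<^sup>2 / real n + 2 * K\<^sup>2 / (real n)\<^sup>2) / c"
      by (intro eventually_sequentiallyI[of 1]) simp
    moreover have "(\<lambda>n. (2 * b\<^sup>2 / real n + 2 * K\<^sup>2 / (real n)\<^sup>2) / c) \<longlonglongrightarrow> 0"
    proof -
      \<comment> \<open>The quadratic term is split into two factors of order \<open>1 / n\<close>,
        so that each piece is a constant over \<open>n\<close>.\<close>
      have "(\<lambda>n. (2 * b\<^sup>2 / real n + 2 * K\<^sup>2 / real n * (1 / real n)) * inverse c)
          \<longlonglongrightarrow> (0 + 0 * 0) * inverse c"
        by (intro tendsto_mult tendsto_add lim_const_over_n tendsto_const)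
      then show ?thesis
        by (simp add: power2_eq_square divide_inverse mult.assoc)
    qed
    ultimately have "P \<longlonglongrightarrow> 0"
      by (rule Lim_null_comparison)
    then show "(\<lambda>n. prob {\<omega> \<in> space M. \<bar>hawkes_compensator M \<xi> n \<omega> / real n - \<beta> 0 / (1 - b)\<bar> > \<epsilon>}) \<longlonglongrightarrow> 0"
      by (simp add: P_def[abs_def])
  qed
qed

end
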